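(* Let $l\ge 2$, let $(X_k,A_k,\mu_k)$, $k=1,\dots,l$, be measure spaces with non-trivial sigma-finite separable measures, let $\vec p=(p_1,\dots,p_l)$ with $1\le p_k<\infty$ for every $k$, and put $\overline p=\max(p_1,\dots,p_l)$. Suppose $\overline p\ge 2$. Let $\xi=\xi(\vec x)=\xi(\vec x,\omega)$, $\vec x\in \prod_{k=1}^l X_k$, $\omega\in\Omega$, be a centered jointly measurable real-valued random field, let $\xi_1,\xi_2,\dots$ be independent copies of $\xi$, and put $S_n(\vec x)=n^{-1/2}\sum_{k=1}^n\xi_k(\vec x)$. Let $m\ge 1$ be a real number (not necessarily an integer) for which the function $$\vec x\mapsto\left[\mathbf E|\xi(\vec x)|^{m\overline p}\right]^{1/(m\overline p)}$$ belongs to $L_{\vec p}$. Then $$\sup_{n\ge1}\left[\mathbf E\,|S_n(\cdot)|_{\vec p}^{\,m\overline p}\right]^{1/(m\overline p)}\le K_R(m\overline p)\cdot\left|\left[\mathbf E|\xi(\vec x)|^{m\overline p}\right]^{1/(m\overline p)}\right|_{\vec p}.$$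
   Context: All random objects are defined on a probability space $(\Omega,F,\mathbf P)$ with expectation $\mathbf E$. A sigma-finite measure $\mu_k$ on $(X_k,A_k)$ is called separable if the sets in $A_k$ of finite measure form a separable (pseudo)metric space for the distance $\rho_k(D_1,D_2)=\mu_k(D_1\setminus D_2)+\mu_k(D_2\setminus D_1)$. The mixed (anisotropic) Lebesgue space $L_{\vec p}$ consists of the (classes of) measurable functions $f:\prod_{k=1}^l X_k\to\mathbb R$ with finite norm $$|f|_{\vec p}=\left(\int_{X_l}\mu_l(dx_l)\left(\int_{X_{l-1}}\mu_{l-1}(dx_{l-1})\cdots\left(\int_{X_1}|f(\vec x)|^{p_1}\mu_1(dx_1)\right)^{p_2/p_1}\cdots\right)^{p_l/p_{l-1}}\right)^{1/p_l},$$ the innermost integration being over $X_1$ with exponent $p_1$ and the outermost over $X_l$ with exponent $p_l$. On the left-hand side of the inequality the norm $|\cdot|_{\vec p}$ is taken in $\vec x$ for fixed $\omega$, and then the expectation is taken; on the right-hand side the expectation is taken first, for fixed $\vec x$. Centered means $\mathbf E\,\xi(\vec x)=0$ for almost every $\vec x$. The $\xi_k$ are jointly measurable fields that are independent and distributed as $\xi$. The Rosenthal constant is, for $q\ge1$, $$K_R(q)=\sup_{n\ge1}\ \sup_{\{\zeta_k\}}\frac{\left|n^{-1/2}\sum_{k=1}^n\zeta_k\right|_q}{|\zeta_1|_q},\qquad |\zeta|_q=\left[\mathbf E|\zeta|^q\right]^{1/q},$$ where the inner supremum is over all sequences $\{\zeta_k\}$ of i.i.d. centered real random variables with $0<|\zeta_1|_q<\infty$.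 (It is finite for $q\ge2$.) *)

theory Defs
  imports "HOL-Probability.Probability"
begin

text \<open>Norms and moments are computed in \<open>ennreal\<close>, so that the suprema and the iterated
  integrals below are defined without integrability side conditions.\<close>

text \<open>\<open>z\<^sup>a\<close> on \<open>[0, \<infinity>]\<close>, only meant for exponents \<open>a > 0\<close>; then \<open>\<infinity>\<^sup>a = \<infinity>\<close> and \<open>0\<^sup>a = 0\<close>.\<close>

definition epowr :: "ennreal \<Rightarrow> real \<Rightarrow> ennreal" (infixr "epowr" 80) where
  "z epowr a = (if z = \<top> then \<top> else ennreal (enn2real z powr a))"

definition separable_measure :: "'a measure \<Rightarrow> bool" where
  "separable_measure M \<longleftrightarrow>
    (\<exists>\<C>. countable \<C> \<and> \<C> \<subseteq> {A \<in> sets M. emeasure M A < \<infinity>} \<and>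
      (\<forall>D \<in> sets M. emeasure M D < \<infinity> \<longrightarrow>
        (\<forall>e>0. \<exists>C\<in>\<C>. emeasure M (D - C) + emeasure M (C - D) < ennreal e)))"

text \<open>The iterated integral without its outermost root. A point of the product space is a
  function on the indices \<open>1, \<dots>, l\<close> (an element of \<open>space (PiM {1..l} M)\<close>).
  \<open>mixed_integral M p F k x\<close> has integrated out the coordinates \<open>1, \<dots>, k\<close>, coordinate 1
  innermost; the values of \<open>x\<close> at these coordinates are overwritten.\<close>

fun mixed_integral ::
  "(nat \<Rightarrow> 'a measure) \<Rightarrow> (nat \<Rightarrow> real) \<Rightarrow> ((nat \<Rightarrow> 'a) \<Rightarrow> ennreal) \<Rightarrow> nat \<Rightarrow> (nat \<Rightarrow> 'a) \<Rightarrow> ennreal"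
where
  "mixed_integral M p F 0 x = F x"
| "mixed_integral M p F (Suc 0) x = (\<integral>\<^sup>+ y. F (x(1 := y)) epowr p 1 \<partial>M 1)"
| "mixed_integral M p F (Suc (Suc k)) x =
    (\<integral>\<^sup>+ y. mixed_integral M p F (Suc k) (x(k + 2 := y)) epowr (p (k + 2) / p (k + 1)) \<partial>M (k + 2))"

text \<open>The base point \<open>\<lambda>_. undefined\<close> makes the points at which \<open>F\<close> is evaluated extensional,
  i.e. elements of \<open>space (PiM {1..l} M)\<close>. The norm of a real function \<open>f\<close> is obtained with
  \<open>F x = \<bar>f x\<bar>\<close>.\<close>

definition mixed_norm ::
  "nat \<Rightarrow> (nat \<Rightarrow> 'a measure) \<Rightarrow> (nat \<Rightarrow> real) \<Rightarrow> ((nat \<Rightarrow> 'a) \<Rightarrow> ennreal) \<Rightarrow> ennreal" where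
  "mixed_norm l M p F = mixed_integral M p F l (\<lambda>_. undefined) epowr (1 / p l)"

text \<open>Nonnegative members of the mixed Lebesgue space. The value \<open>\<infinity>\<close> is formally allowed,
  but a finite norm confines it to a null set.\<close>

definition mixed_Lp ::
  "nat \<Rightarrow> (nat \<Rightarrow> 'a measure) \<Rightarrow> (nat \<Rightarrow> real) \<Rightarrow> ((nat \<Rightarrow> 'a) \<Rightarrow> ennreal) set" where
  "mixed_Lp l M p = {F \<in> borel_measurable (PiM {1..l} M). mixed_norm l M p F < \<infinity>}"

definition moment_norm :: "'w measure \<Rightarrow> real \<Rightarrow> ('w \<Rightarrow> ennreal) \<Rightarrow> ennreal" where
  "moment_norm P q Z = (\<integral>\<^sup>+ \<omega>. Z \<omega> epowr q \<partial>P) epowr (1 / q)"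

text \<open>Integrability is explicit because the Bochner integral of a non-integrable function is 0.\<close>

definition centered :: "'w measure \<Rightarrow> ('w \<Rightarrow> real) \<Rightarrow> bool" where
  "centered P Z \<longleftrightarrow> integrable P Z \<and> (\<integral>\<omega>. Z \<omega> \<partial>P) = 0"

definition normalized_sum :: "(nat \<Rightarrow> real) \<Rightarrow> nat \<Rightarrow> real" where
  "normalized_sum z n = real n powr (- 1 / 2) * (\<Sum>k=1..n. z k)"

text \<open>Random elements \<open>Y 1, Y 2, \<dots>\<close> of \<open>N\<close> that are mutually independent and distributed as \<open>X\<close>.\<close>

definition iid_copies ::
  "'w measure \<Rightarrow> 'b measure \<Rightarrow> ('w \<Rightarrow> 'b) \<Rightarrow> (nat \<Rightarrow> 'w \<Rightarrow> 'b) \<Rightarrow> bool" where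
  "iid_copies P N X Y \<longleftrightarrow>
    prob_space.indep_vars P (\<lambda>_. N) Y {1..} \<and> (\<forall>k\<ge>1. distr P N (Y k) = distr P N X)"

text \<open>Independence and equality in distribution of fields refer to their paths, as random
  elements of \<open>\<real>\<^sup>X\<close> with the product sigma-algebra, i.e. to finite-dimensional distributions.
  Only the sigma-algebra of \<open>path_space\<close> is used.\<close>

definition path_space :: "'x set \<Rightarrow> ('x \<Rightarrow> real) measure" where
  "path_space X = PiM X (\<lambda>_. borel)"

definition path :: "'x set \<Rightarrow> ('x \<Rightarrow> 'w \<Rightarrow> real) \<Rightarrow> 'w \<Rightarrow> ('x \<Rightarrow> real)" where
  "path X \<xi> \<omega> = (\<lambda>x\<in>X. \<xi> x \<omega>)"

definition independent_field_copies ::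
  "'w measure \<Rightarrow> 'x set \<Rightarrow> ('x \<Rightarrow> 'w \<Rightarrow> real) \<Rightarrow> (nat \<Rightarrow> 'x \<Rightarrow> 'w \<Rightarrow> real) \<Rightarrow> bool" where
  "independent_field_copies P X \<xi> \<eta> \<longleftrightarrow>
    iid_copies P (path_space X) (path X \<xi>) (\<lambda>k. path X (\<eta> k))"

text \<open>All random variables live on one fixed probability space \<open>P\<close>, and the inner supremum
  ranges over the sequences on \<open>P\<close>. For every \<open>P\<close> carrying i.i.d. sequences of arbitrary law
  the value depends only on \<open>q\<close>; for other \<open>P\<close> it can only be smaller.\<close>

definition rosenthal_const :: "'w measure \<Rightarrow> real \<Rightarrow> ennreal" where
  "rosenthal_const P q =
    (SUP n\<in>{1..}. SUP \<zeta>\<in>{\<zeta>. iid_copies P borel (\<zeta> 1) \<zeta> \<and> centered P (\<zeta> 1) \<and>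
          0 < moment_norm P q (\<lambda>\<omega>. ennreal \<bar>\<zeta> 1 \<omega>\<bar>) \<and>
          moment_norm P q (\<lambda>\<omega>. ennreal \<bar>\<zeta> 1 \<omega>\<bar>) < \<infinity>}.
      moment_norm P q (\<lambda>\<omega>. ennreal \<bar>normalized_sum (\<lambda>k. \<zeta> k \<omega>) n\<bar>)
        / moment_norm P q (\<lambda>\<omega>. ennreal \<bar>\<zeta> 1 \<omega>\<bar>))"

end

theory Submission
  imports Defs
begin

text \<open>
  Put \<open>q = m * pbar\<close>, so that \<open>p k \<le> q\<close> for every \<open>k\<close>. Two facts combine.

  First, the \<open>L\<^sub>q\<close>-norm in \<open>\<omega>\<close> may be pulled inside the mixed norm in \<open>x\<close> at the price of an
  increase (\<open>moment_norm_mixed_norm_le\<close>). One variable at a time this is Minkowski's integral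
  inequality \<open>minkowski_integral\<close> with exponent \<open>q / p k \<ge> 1\<close>: exchanging two norms
  so that the one with the larger exponent is taken first can only increase the value.

  Second, once the expectation is innermost, the point \<open>x\<close> is fixed, and the values at \<open>x\<close> of the
  independent copies of the field are i.i.d. real random variables with the law of \<open>\<xi> x\<close>. For almost
  every \<open>x\<close> they are centered, and the definition of the Rosenthal constant bounds the
  \<open>q\<close>-th moment norm of their normalized sum (\<open>moment_norm_normalized_sum_le\<close>).

  Monotonicity under almost-everywhere inequalities (\<open>mixed_norm_mono_AE\<close>) and homogeneity
  (\<open>mixed_norm_cmult\<close>) of the mixed norm then give the result. All norms live in \<open>[0, \<infinity>]\<close>, where
  \<open>0 * \<infinity> = 0\<close>, so the pointwise bound is used with the constant increased by some \<open>e > 0\<close>, which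
  is removed at the end; this is where the finiteness of the mixed norm enters.
\<close>

section \<open>Powers on the extended half-line\<close>

lemma epowr_top [simp]: "\<top> epowr a = \<top>"
  by (simp add: epowr_def)

lemma epowr_ennreal: "0 \<le> z \<Longrightarrow> ennreal z epowr a = ennreal (z powr a)"
  by (simp add: epowr_def)

lemma epowr_0 [simp]: "0 epowr a = 0"
  by (simp add: epowr_def)

lemma epowr_1 [simp]: "z epowr 1 = z"
  by (cases z) (simp_all add: epowr_ennreal)

lemma epowr_eq_0_iff [simp]: "z epowr a = 0 \<longleftrightarrow> z = 0"
  by (cases z) (auto simp: epowr_ennreal ennreal_eq_0_iff)

lemma epowr_eq_top_iff [simp]: "z epowr a = \<top> \<longleftrightarrow> z = \<top>"
  by (cases z) (auto simp: epowr_ennreal)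

lemma epowr_epowr: "(z epowr a) epowr b = z epowr (a * b)"
  by (cases z) (simp_all add: epowr_ennreal powr_powr)

lemma epowr_mono: "0 \<le> a \<Longrightarrow> z \<le> w \<Longrightarrow> z epowr a \<le> w epowr a"
  by (cases z; cases w) (auto simp: epowr_ennreal top_unique intro!: powr_mono2)

lemma epowr_mult: "(z * w) epowr a = z epowr a * w epowr a"
proof (cases "z = 0 \<or> w = 0 \<or> z = \<top> \<or> w = \<top>")
  case True
  then show ?thesis by (auto simp: ennreal_mult_top ennreal_top_mult)
next
  case False
  then obtain a b where "z = ennreal a" "w = ennreal b" "0 \<le> a" "0 \<le> b"
    by (cases z; cases w) auto
  then show ?thesis
    by (simp add: epowr_ennreal powr_mult flip: ennreal_mult)
qed

lemma measurable_epowr [measurable (raw)]: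
  assumes [measurable]: "f \<in> borel_measurable N"
  shows "(\<lambda>x. f x epowr a) \<in> borel_measurable N"
  unfolding epowr_def by measurable

section \<open>Minkowski's integral inequality\<close>

text \<open>Young's inequality \<open>u v \<le> u\<^sup>r / r + v\<^sup>s / s\<close> with conjugate exponents \<open>r\<close> and \<open>s\<close>, taken
  at \<open>u = f / \<phi>\<close> and \<open>v = t powr (r - 1)\<close> and multiplied by \<open>r \<phi>\<close>. The division is arranged so
  that the degenerate values do no harm: for \<open>\<phi> = 0\<close> and \<open>f > 0\<close> the first term on the right is
  infinite, and for \<open>\<phi> = \<infinity>\<close> the second one is.\<close>

lemma young_weighted:
  fixes f \<phi> :: ennreal
  assumes r: "1 < r" and t: "0 < t"
  shows "ennreal (r * t powr (r - 1)) * f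
    \<le> f epowr r / \<phi> epowr (r - 1) + ennreal ((r - 1) * t powr r) * \<phi>"
proof -
  consider "f = 0" | "\<phi> = \<top>" | "f \<noteq> 0" "\<phi> = 0" | "f = \<top>" "\<phi> \<noteq> 0" "\<phi> \<noteq> \<top>"
    | a b where "f = ennreal a" "\<phi> = ennreal b" "0 < a" "0 < b"
    by (cases f; cases \<phi>) (auto simp: less_le)
  then show ?thesis
  proof cases
    case 1
    then show ?thesis by simp
  next
    case 2
    then show ?thesis using assms by (simp add: ennreal_mult_top)
  next
    case 3
    then show ?thesis by simp
  next
    case 4
    then show ?thesis by (simp add: ennreal_top_divide)
  next
    case (5 a b)
    have "a / b * t powr (r - 1)
      \<le> (a / b) powr r / r + (t powr (r - 1)) powr (r / (r - 1)) / (r / (r - 1))"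
      using 5 r t by (intro Youngs_inequality) (auto simp: field_simps)
    also have "(t powr (r - 1)) powr (r / (r - 1)) = t powr r"
      using r by (simp add: powr_powr)
    finally have "r * b * (a / b * t powr (r - 1))
      \<le> r * b * ((a / b) powr r / r + t powr r / (r / (r - 1)))"
      using 5 r by (intro mult_left_mono) auto
    also have "\<dots> = b * (a / b) powr r + (r - 1) * t powr r * b"
      using r by (simp add: field_simps)
    also have "b * (a / b) powr r = a powr r / b powr (r - 1)"
      using 5 by (simp add: powr_divide powr_diff)
    finally have "r * t powr (r - 1) * a \<le> a powr r / b powr (r - 1) + (r - 1) * t powr r * b"
      using 5 by (simp add: algebra_simps)
    then have "ennreal (r * t powr (r - 1) * a) \<le>
      ennreal (a powr r / b powr (r - 1) + (r - 1) * t powr r * b)"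
      by (rule ennreal_leI)
    then show ?thesis
      using 5 r t
      by (simp add: epowr_ennreal ennreal_mult ennreal_plus divide_ennreal)
  qed
qed

text \<open>Let \<open>\<phi> y\<close> be the \<open>L\<^sub>r\<close>-norm of \<open>f _ y\<close>, \<open>H\<close> the inner integral on the left and \<open>A = \<integral>\<phi>\<close>.
  Integrating Young's inequality over \<open>y\<close>, with a parameter \<open>t\<close> that may depend on \<open>\<omega>\<close>, bounds
  \<open>H\<close> by \<open>A\<close> and by \<open>B \<omega> = \<integral> (f powr r) / \<phi> powr (r - 1)\<close>. The choice \<open>t = H \<omega> / A\<close> turns the bound into
  \<open>H powr r \<le> A powr (r - 1) * B\<close>, and \<open>B\<close> has integral at most \<open>\<integral>\<phi> = A\<close> by Fubini. Unlike the
  proof by duality, which divides by the norm of \<open>H\<close>, this argument does not have to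
  truncate \<open>H\<close> to make that norm finite.\<close>

lemma minkowski_integral:
  assumes "sigma_finite_measure P" "sigma_finite_measure N"
    and f [measurable]: "(\<lambda>(\<omega>, y). f \<omega> y) \<in> borel_measurable (P \<Otimes>\<^sub>M N)"
    and r: "1 \<le> r"
  shows "(\<integral>\<^sup>+\<omega>. (\<integral>\<^sup>+y. f \<omega> y \<partial>N) epowr r \<partial>P) epowr (1 / r)
    \<le> (\<integral>\<^sup>+y. (\<integral>\<^sup>+\<omega>. f \<omega> y epowr r \<partial>P) epowr (1 / r) \<partial>N)"
proof -
  interpret P: sigma_finite_measure P by fact
  interpret N: sigma_finite_measure N by fact
  interpret PN: pair_sigma_finite P N ..
  have f' [measurable]: "(\<lambda>(y, \<omega>). f \<omega> y) \<in> borel_measurable (N \<Otimes>\<^sub>M P)"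
    by measurable
  have fubini: "(\<integral>\<^sup>+\<omega>. \<integral>\<^sup>+y. g \<omega> y \<partial>N \<partial>P) = (\<integral>\<^sup>+y. \<integral>\<^sup>+\<omega>. g \<omega> y \<partial>P \<partial>N)"
    if "(\<lambda>(\<omega>, y). g \<omega> y) \<in> borel_measurable (P \<Otimes>\<^sub>M N)" for g :: "'a \<Rightarrow> 'b \<Rightarrow> ennreal"
    using PN.Fubini'[OF that] by simp
  define \<phi> where "\<phi> y = (\<integral>\<^sup>+\<omega>. f \<omega> y epowr r \<partial>P) epowr (1 / r)" for y
  define H where "H \<omega> = (\<integral>\<^sup>+y. f \<omega> y \<partial>N)" for \<omega>
  define A where "A = (\<integral>\<^sup>+y. \<phi> y \<partial>N)"
  have [measurable]: "\<phi> \<in> borel_measurable N" "H \<in> borel_measurable P"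
    unfolding \<phi>_def H_def by measurable
  have "(\<integral>\<^sup>+\<omega>. H \<omega> epowr r \<partial>P) \<le> A epowr r"
  proof (cases "r = 1 \<or> A = 0 \<or> A = \<top>")
    case True
    moreover have ?thesis if "r = 1"
      using that fubini[OF f] by (simp add: H_def A_def \<phi>_def)
    moreover have ?thesis if "A = 0"
    proof -
      have "AE y in N. (\<integral>\<^sup>+\<omega>. f \<omega> y \<partial>P) = 0"
      proof -
        have "AE y in N. \<phi> y = 0"
          using that by (simp add: A_def nn_integral_0_iff_AE)
        with AE_space show ?thesis
        proof eventually_elim
          case (elim y)
          note [measurable] = \<open>y \<in> space N\<close>
          have "AE \<omega> in P. f \<omega> y epowr r = 0"
            using elim by (simp add: \<phi>_def nn_integral_0_iff_AE)
          then show ?case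
            by (simp add: nn_integral_0_iff_AE)
        qed
      qed
      then have "(\<integral>\<^sup>+\<omega>. H \<omega> \<partial>P) = 0"
        unfolding H_def fubini[OF f] by (subst nn_integral_0_iff_AE) auto
      then have "AE \<omega> in P. H \<omega> = 0"
        by (subst (asm) nn_integral_0_iff_AE) auto
      then have "(\<integral>\<^sup>+\<omega>. H \<omega> epowr r \<partial>P) = 0"
        by (subst nn_integral_0_iff_AE) auto
      then show ?thesis by simp
    qed
    moreover have ?thesis if "A = \<top>"
      using that by simp
    ultimately show ?thesis by blast
  next
    case False
    then have r: "1 < r" and A: "A \<noteq> 0" "A \<noteq> \<top>"
      using r by auto
    obtain a where a: "A = ennreal a" "0 < a"
      using A by (cases A) (auto simp: less_le)
    define B where "B \<omega> = (\<integral>\<^sup>+y. f \<omega> y epowr r / \<phi> y epowr (r - 1) \<partial>N)" for \<omega>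
    have [measurable]: "B \<in> borel_measurable P"
      unfolding B_def by measurable
    have integrated: "ennreal (r * t powr (r - 1)) * H \<omega> \<le> B \<omega> + ennreal ((r - 1) * t powr r) * A"
      if [measurable]: "\<omega> \<in> space P" and t: "0 < t" for \<omega> t
    proof -
      have "ennreal (r * t powr (r - 1)) * H \<omega> = (\<integral>\<^sup>+y. ennreal (r * t powr (r - 1)) * f \<omega> y \<partial>N)"
        unfolding H_def by (rule nn_integral_cmult[symmetric]) measurable
      also have "\<dots> \<le> (\<integral>\<^sup>+y. f \<omega> y epowr r / \<phi> y epowr (r - 1)
          + ennreal ((r - 1) * t powr r) * \<phi> y \<partial>N)"
        by (intro nn_integral_mono young_weighted r t)
      also have "\<dots> = B \<omega> + ennreal ((r - 1) * t powr r) * A"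
        unfolding B_def A_def by (subst nn_integral_add) (auto intro!: nn_integral_cmult)
      finally show ?thesis .
    qed
    have bound: "H \<omega> epowr r \<le> A epowr (r - 1) * B \<omega>" if \<omega>: "\<omega> \<in> space P" for \<omega>
    proof (cases "H \<omega>")
      case (real h)
      show ?thesis
      proof (cases "h = 0 \<or> B \<omega> = \<top>")
        case True
        then show ?thesis using real A by (auto simp: ennreal_mult_top)
      next
        case False
        then obtain b where b: "B \<omega> = ennreal b" "0 \<le> b" by (cases "B \<omega>") auto
        have h: "0 < h" using False real by auto
        have "ennreal (r * (h / a) powr (r - 1) * h) \<le> ennreal (b + (r - 1) * (h / a) powr r * a)"
          using integrated[OF \<omega>, of "h / a"] h a b r real
          by (simp add: ennreal_mult ennreal_plus)
        then have "r * ((h / a) powr (r - 1) * h) \<le> b + (r - 1) * ((h / a) powr r * a)"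
          using h a b r by (subst (asm) ennreal_le_iff) (auto simp: mult.assoc)
        moreover have "(h / a) powr (r - 1) * h = h powr r / a powr (r - 1)"
          "(h / a) powr r * a = h powr r / a powr (r - 1)"
          using h a by (simp_all add: powr_divide powr_diff)
        ultimately have "r * (h powr r / a powr (r - 1)) \<le> b + (r - 1) * (h powr r / a powr (r - 1))"
          by (simp only:)
        then have "h powr r / a powr (r - 1) \<le> b"
          unfolding left_diff_distrib mult_1_left by linarith
        then have "h powr r \<le> a powr (r - 1) * b"
          using a by (simp add: field_simps)
        then show ?thesis
          using real a b h by (simp add: epowr_ennreal flip: ennreal_mult)
      qed
    next
      case top
      \<comment> \<open>Here \<open>t = H \<omega> / A\<close> is not available, but any \<open>t\<close> shows that \<open>B \<omega>\<close> is infinite, since \<open>A\<close> is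
        finite.\<close>
      then have "B \<omega> = \<top>"
        using integrated[OF \<omega>, of 1] r a by (simp add: ennreal_mult_top top_unique flip: ennreal_mult)
      then show ?thesis using A by (simp add: ennreal_mult_top)
    qed
    have "(\<integral>\<^sup>+\<omega>. B \<omega> \<partial>P) = (\<integral>\<^sup>+y. \<integral>\<^sup>+\<omega>. f \<omega> y epowr r / \<phi> y epowr (r - 1) \<partial>P \<partial>N)"
      unfolding B_def by (rule fubini) measurable
    also have "\<dots> \<le> (\<integral>\<^sup>+y. \<phi> y \<partial>N)"
    proof (rule nn_integral_mono)
      fix y assume [measurable]: "y \<in> space N"
      have "(\<integral>\<^sup>+\<omega>. f \<omega> y epowr r / \<phi> y epowr (r - 1) \<partial>P)
        = (\<integral>\<^sup>+\<omega>. f \<omega> y epowr r \<partial>P) / \<phi> y epowr (r - 1)"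
        by (rule nn_integral_divide) measurable
      also have "(\<integral>\<^sup>+\<omega>. f \<omega> y epowr r \<partial>P) = \<phi> y epowr r"
        using r by (simp add: \<phi>_def epowr_epowr)
      also have "\<phi> y epowr r / \<phi> y epowr (r - 1) \<le> \<phi> y"
      proof (cases "\<phi> y")
        case (real u)
        then show ?thesis
          by (cases "u = 0") (auto simp: epowr_ennreal divide_ennreal powr_diff)
      qed simp
      finally show "(\<integral>\<^sup>+\<omega>. f \<omega> y epowr r / \<phi> y epowr (r - 1) \<partial>P) \<le> \<phi> y" .
    qed
    finally have EB: "(\<integral>\<^sup>+\<omega>. B \<omega> \<partial>P) \<le> A"
      by (simp add: A_def)
    have "(\<integral>\<^sup>+\<omega>. H \<omega> epowr r \<partial>P) \<le> (\<integral>\<^sup>+\<omega>. A epowr (r - 1) * B \<omega> \<partial>P)"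
      by (intro nn_integral_mono bound)
    also have "\<dots> = A epowr (r - 1) * (\<integral>\<^sup>+\<omega>. B \<omega> \<partial>P)"
      by (rule nn_integral_cmult) measurable
    also have "\<dots> \<le> A epowr (r - 1) * A"
      by (intro mult_left_mono EB) simp
    also have "\<dots> = A epowr r"
      using a by (simp add: epowr_ennreal powr_diff flip: ennreal_mult)
    finally show ?thesis .
  qed
  then have "(\<integral>\<^sup>+\<omega>. H \<omega> epowr r \<partial>P) epowr (1 / r) \<le> (A epowr r) epowr (1 / r)"
    using r by (intro epowr_mono) auto
  also have "\<dots> = A"
    using r by (simp add: epowr_epowr)
  finally show ?thesis
    by (simp add: H_def A_def \<phi>_def)
qed

section \<open>Mixed norms\<close>

text \<open>The iterated integrals with the root taken at every stage. Each stage is then an ordinary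
  \<open>L\<^sub>p\<close>-norm in one variable, homogeneous of degree 1, and all stages \<open>k > 0\<close> have the same form;
  this makes inductions over the number of variables uniform.\<close>

primrec partial_mixed_norm ::
  "(nat \<Rightarrow> 'a measure) \<Rightarrow> (nat \<Rightarrow> real) \<Rightarrow> ((nat \<Rightarrow> 'a) \<Rightarrow> ennreal) \<Rightarrow> nat \<Rightarrow> (nat \<Rightarrow> 'a) \<Rightarrow> ennreal"
where
  "partial_mixed_norm M p F 0 x = F x"
| "partial_mixed_norm M p F (Suc k) x =
    (\<integral>\<^sup>+ y. partial_mixed_norm M p F k (x(Suc k := y)) epowr p (Suc k) \<partial>M (Suc k)) epowr (1 / p (Suc k))"

lemma mixed_integral_eq_partial_mixed_norm:
  assumes "1 \<le> k" "\<And>j. j \<in> {1..k} \<Longrightarrow> p j \<noteq> 0"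
  shows "mixed_integral M p F k x = partial_mixed_norm M p F k x epowr p k"
  using assms
proof (induction M p F k x rule: mixed_integral.induct)
  case (2 M p F x)
  then show ?case by (simp add: epowr_epowr)
next
  case (3 M p F k x)
  have IH: "mixed_integral M p F (Suc k) (x(k + 2 := y))
      = partial_mixed_norm M p F (Suc k) (x(k + 2 := y)) epowr p (Suc k)" for y
    by (rule 3) (use 3 in auto)
  have "p (Suc k) \<noteq> 0" "p (Suc (Suc k)) \<noteq> 0"
    by (auto intro!: 3)
  moreover have "k + 2 = Suc (Suc k)" "k + 1 = Suc k"
    by simp_all
  ultimately show ?case
    unfolding mixed_integral.simps IH partial_mixed_norm.simps(2)[of M p F "Suc k" x]
    by (simp only: epowr_epowr) simp
qed simp

lemma mixed_norm_eq_partial_mixed_norm: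
  assumes "1 \<le> l" "\<And>j. j \<in> {1..l} \<Longrightarrow> p j \<noteq> 0"
  shows "mixed_norm l M p F = partial_mixed_norm M p F l (\<lambda>_. undefined)"
proof -
  have "mixed_integral M p F l x = partial_mixed_norm M p F l x epowr p l" for x
    by (rule mixed_integral_eq_partial_mixed_norm) (use assms in auto)
  moreover have "p l \<noteq> 0"
    using assms by simp
  ultimately show ?thesis
    by (simp add: mixed_norm_def epowr_epowr)
qed

text \<open>By Fubini almost every section of a null set is null. To place the measures into a family
  that is sigma-finite at every index, those with indices outside the product are replaced by a
  one-point measure, which does not change the two products.\<close>

lemma AE_PiM_insert_section:
  assumes I: "finite I" "i \<notin> I"
    and M: "\<And>j. j \<in> insert i I \<Longrightarrow> sigma_finite_measure (M j)"
    and Q: "AE z in PiM (insert i I) M. Q z"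
  shows "AE x in PiM I M. AE y in M i. Q (x(i := y))"
proof -
  define M' where "M' j = (if j \<in> insert i I then M j else count_space {undefined})" for j
  interpret M': product_sigma_finite M'
    using M by (intro product_sigma_finite.intro)
      (simp add: M'_def sigma_finite_measure_count_space_finite)
  have PiM_eq: "PiM I M = PiM I M'" "PiM (insert i I) M = PiM (insert i I) M'" "M i = M' i"
    by (auto simp: M'_def intro!: PiM_cong)
  interpret i: sigma_finite_measure "M' i" by (rule M'.sigma_finite_measures)
  from Q obtain N where N: "{z \<in> space (PiM (insert i I) M'). \<not> Q z} \<subseteq> N"
    and N0: "emeasure (PiM (insert i I) M') N = 0" and [measurable]: "N \<in> sets (PiM (insert i I) M')"
    unfolding PiM_eq by (auto elim!: AE_E)
  have upd [measurable]: "(\<lambda>(x, y). x(i := y)) \<in> PiM I M' \<Otimes>\<^sub>M M' i \<rightarrow>\<^sub>M PiM (insert i I) M'"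
    by (rule measurable_add_dim)
  have "0 = (\<integral>\<^sup>+z. indicator N z \<partial>PiM (insert i I) M')"
    using N0 by simp
  also have "\<dots> = (\<integral>\<^sup>+x. \<integral>\<^sup>+y. indicator N (x(i := y)) \<partial>M' i \<partial>PiM I M')"
    by (rule M'.product_nn_integral_insert[OF I]) measurable
  finally have "AE x in PiM I M'. (\<integral>\<^sup>+y. indicator N (x(i := y)) \<partial>M' i) = 0"
    by (subst (asm) eq_commute, subst (asm) nn_integral_0_iff_AE) measurable
  with AE_space have "AE x in PiM I M'. AE y in M' i. Q (x(i := y))"
  proof eventually_elim
    case (elim x)
    note [measurable] = \<open>x \<in> space (PiM I M')\<close>
    have "AE y in M' i. indicator N (x(i := y)) = (0 :: ennreal)"
      using elim(2) by (subst (asm) nn_integral_0_iff_AE) measurable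
    with AE_space show ?case
    proof eventually_elim
      case (elim y)
      then have "(case (x, y) of (x, y) \<Rightarrow> x(i := y)) \<in> space (PiM (insert i I) M')"
        using \<open>x \<in> _\<close> by (intro measurable_space[OF upd]) (auto simp: space_pair_measure)
      then show ?case
        using elim N by (auto simp: indicator_def split: if_splits)
    qed
  qed
  then show ?thesis
    unfolding PiM_eq .
qed

text \<open>An exceptional null set in the full product survives the first integrations as a null set
  of the remaining variables, so the inequality is propagated almost everywhere, and only after
  the last variable, on a one-point space, does it hold without exception.\<close>

lemma partial_mixed_norm_mono_AE:
  assumes M: "\<And>j. j \<in> {1..l} \<Longrightarrow> sigma_finite_measure (M j)"
    and p: "\<And>j. j \<in> {1..l} \<Longrightarrow> 0 \<le> p j"
    and le: "AE x in PiM {1..l} M. F x \<le> G x"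
    and "k \<le> l"
  shows "AE x in PiM {Suc k..l} M. partial_mixed_norm M p F k x \<le> partial_mixed_norm M p G k x"
  using \<open>k \<le> l\<close>
proof (induction k)
  case 0
  then show ?case using le unfolding One_nat_def partial_mixed_norm.simps by blast
next
  case (Suc k)
  have ins: "{Suc k..l} = insert (Suc k) {Suc (Suc k)..l}"
    using Suc.prems by auto
  have "AE x in PiM {Suc (Suc k)..l} M. AE y in M (Suc k).
      partial_mixed_norm M p F k (x(Suc k := y)) \<le> partial_mixed_norm M p G k (x(Suc k := y))"
    using Suc unfolding ins by (intro AE_PiM_insert_section M) auto
  then show ?case
  proof eventually_elim
    case (elim x)
    then have "AE y in M (Suc k). partial_mixed_norm M p F k (x(Suc k := y)) epowr p (Suc k)
      \<le> partial_mixed_norm M p G k (x(Suc k := y)) epowr p (Suc k)"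
      by eventually_elim (use Suc.prems p in \<open>auto intro!: epowr_mono\<close>)
    then show ?case
      using Suc.prems p by (auto intro!: epowr_mono nn_integral_mono_AE)
  qed
qed

lemma mixed_norm_mono_AE:
  assumes "1 \<le> l"
    and M: "\<And>j. j \<in> {1..l} \<Longrightarrow> sigma_finite_measure (M j)"
    and p: "\<And>j. j \<in> {1..l} \<Longrightarrow> 0 < p j"
    and le: "AE x in PiM {1..l} M. F x \<le> G x"
  shows "mixed_norm l M p F \<le> mixed_norm l M p G"
proof -
  have "AE x in PiM {Suc l..l} M. partial_mixed_norm M p F l x \<le> partial_mixed_norm M p G l x"
    by (intro partial_mixed_norm_mono_AE[where l = l] M le less_imp_le[OF p]) auto
  moreover have "{Suc l..l} = {}"
    by simp
  ultimately have "AE x in PiM {} M. partial_mixed_norm M p F l x \<le> partial_mixed_norm M p G l x"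
    by metis
  then have le: "partial_mixed_norm M p F l (\<lambda>_. undefined) \<le> partial_mixed_norm M p G l (\<lambda>_. undefined)"
    unfolding PiM_empty by (simp add: AE_count_space)
  have "p j \<noteq> 0" if "j \<in> {1..l}" for j
    using p[OF that] by simp
  then have eq: "mixed_norm l M p H = partial_mixed_norm M p H l (\<lambda>_. undefined)" for H
    using \<open>1 \<le> l\<close> by (intro mixed_norm_eq_partial_mixed_norm)
  show ?thesis
    unfolding eq by (rule le)
qed

text \<open>The parameter \<open>\<omega>\<close> is carried along because Minkowski's inequality needs joint measurability
  in \<open>\<omega>\<close> and the variable that is integrated out next.\<close>

lemma measurable_partial_mixed_norm:
  assumes M: "\<And>j. j \<in> {1..l} \<Longrightarrow> sigma_finite_measure (M j)"
    and F: "(\<lambda>(x, \<omega>). F \<omega> x) \<in> borel_measurable (PiM {1..l} M \<Otimes>\<^sub>M N)"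
    and "k \<le> l"
  shows "(\<lambda>(x, \<omega>). partial_mixed_norm M p (F \<omega>) k x) \<in> borel_measurable (PiM {Suc k..l} M \<Otimes>\<^sub>M N)"
  using \<open>k \<le> l\<close>
proof (induction k)
  case 0
  then show ?case using F by simp
next
  case (Suc k)
  interpret sigma_finite_measure "M (Suc k)"
    using Suc.prems by (intro M) auto
  have [measurable]: "(\<lambda>z. (fst (fst z))(Suc k := snd z))
    \<in> (PiM {Suc (Suc k)..l} M \<Otimes>\<^sub>M N) \<Otimes>\<^sub>M M (Suc k) \<rightarrow>\<^sub>M PiM {Suc k..l} M"
    by (rule measurable_fun_upd[where J = "{Suc (Suc k)..l}"]) (use Suc.prems in auto)
  have [measurable]: "(\<lambda>(x, \<omega>). partial_mixed_norm M p (F \<omega>) k x)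
      \<in> borel_measurable (PiM {Suc k..l} M \<Otimes>\<^sub>M N)"
    using Suc by simp
  have "(\<lambda>z. (\<lambda>(x, \<omega>). partial_mixed_norm M p (F \<omega>) k x)
      ((fst (fst z))(Suc k := snd z), snd (fst z)) epowr p (Suc k))
    \<in> borel_measurable ((PiM {Suc (Suc k)..l} M \<Otimes>\<^sub>M N) \<Otimes>\<^sub>M M (Suc k))"
    by measurable
  then have [measurable]: "(\<lambda>(z, y). partial_mixed_norm M p (F (snd z)) k ((fst z)(Suc k := y)) epowr p (Suc k))
    \<in> borel_measurable ((PiM {Suc (Suc k)..l} M \<Otimes>\<^sub>M N) \<Otimes>\<^sub>M M (Suc k))"
    by (simp add: case_prod_beta)
  have "(\<lambda>z. partial_mixed_norm M p (F (snd z)) (Suc k) (fst z))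
      \<in> borel_measurable (PiM {Suc (Suc k)..l} M \<Otimes>\<^sub>M N)"
    unfolding partial_mixed_norm.simps by measurable
  then show ?case
    by (simp add: case_prod_beta)
qed

lemma fun_upd_in_space_PiM:
  assumes "x \<in> space (PiM {Suc k..l} M)" "y \<in> space (M k)" "k \<le> l"
  shows "x(k := y) \<in> space (PiM {k..l} M)"
  using assms by (auto simp: space_PiM PiE_iff extensional_def)

lemma measurable_partial_mixed_norm_section:
  assumes M: "\<And>j. j \<in> {1..l} \<Longrightarrow> sigma_finite_measure (M j)"
    and F: "(\<lambda>(x, \<omega>). F \<omega> x) \<in> borel_measurable (PiM {1..l} M \<Otimes>\<^sub>M N)"
    and k: "k < l" and x: "x \<in> space (PiM {Suc (Suc k)..l} M)"
  shows "(\<lambda>(\<omega>, y). partial_mixed_norm M p (F \<omega>) k (x(Suc k := y)))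
    \<in> borel_measurable (N \<Otimes>\<^sub>M M (Suc k))"
proof -
  have [measurable]: "(\<lambda>z. x(Suc k := snd z)) \<in> N \<Otimes>\<^sub>M M (Suc k) \<rightarrow>\<^sub>M PiM {Suc k..l} M"
    by (rule measurable_fun_upd[where J = "{Suc (Suc k)..l}"]) (use k x in auto)
  have [measurable]: "(\<lambda>(x, \<omega>). partial_mixed_norm M p (F \<omega>) k x)
      \<in> borel_measurable (PiM {Suc k..l} M \<Otimes>\<^sub>M N)"
    using k by (intro measurable_partial_mixed_norm M F) auto
  have "(\<lambda>z. (\<lambda>(x, \<omega>). partial_mixed_norm M p (F \<omega>) k x) (x(Suc k := snd z), fst z))
    \<in> borel_measurable (N \<Otimes>\<^sub>M M (Suc k))"
    by measurable
  then show ?thesis by (simp add: case_prod_beta)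
qed

text \<open>The factor \<open>c = \<infinity>\<close> is included; it occurs when the Rosenthal constant is infinite.\<close>

lemma partial_mixed_norm_cmult:
  assumes M: "\<And>j. j \<in> {1..l} \<Longrightarrow> sigma_finite_measure (M j)"
    and p: "\<And>j. j \<in> {1..l} \<Longrightarrow> p j \<noteq> 0"
    and F: "F \<in> borel_measurable (PiM {1..l} M)"
    and "k \<le> l" and "x \<in> space (PiM {Suc k..l} M)"
  shows "partial_mixed_norm M p (\<lambda>x. c * F x) k x = c * partial_mixed_norm M p F k x"
  using \<open>k \<le> l\<close> \<open>x \<in> _\<close>
proof (induction k arbitrary: x)
  case (Suc k)
  \<comment> \<open>A function without parameter is one with a parameter from a one-point space.\<close>
  have "(\<lambda>(x, \<omega>). F x) \<in> borel_measurable (PiM {1..l} M \<Otimes>\<^sub>M count_space {()})"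
    using F by measurable
  then have "(\<lambda>(\<omega>, y). partial_mixed_norm M p F k (x(Suc k := y)))
      \<in> borel_measurable (count_space {()} \<Otimes>\<^sub>M M (Suc k))"
    using Suc.prems by (intro measurable_partial_mixed_norm_section M) auto
  from measurable_compose_Pair1[OF _ this, of "()"]
  have [measurable]: "(\<lambda>y. partial_mixed_norm M p F k (x(Suc k := y))) \<in> borel_measurable (M (Suc k))"
    by simp
  have "(\<integral>\<^sup>+ y. partial_mixed_norm M p (\<lambda>x. c * F x) k (x(Suc k := y)) epowr p (Suc k) \<partial>M (Suc k))
    = (\<integral>\<^sup>+ y. c epowr p (Suc k) * partial_mixed_norm M p F k (x(Suc k := y)) epowr p (Suc k) \<partial>M (Suc k))"
    using Suc by (intro nn_integral_cong) (simp add: fun_upd_in_space_PiM epowr_mult)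
  then show ?case
    using Suc.prems p by (simp add: nn_integral_cmult epowr_mult epowr_epowr)
qed simp

lemma mixed_norm_cmult:
  assumes "1 \<le> l"
    and M: "\<And>j. j \<in> {1..l} \<Longrightarrow> sigma_finite_measure (M j)"
    and p: "\<And>j. j \<in> {1..l} \<Longrightarrow> p j \<noteq> 0"
    and F: "F \<in> borel_measurable (PiM {1..l} M)"
  shows "mixed_norm l M p (\<lambda>x. c * F x) = c * mixed_norm l M p F"
proof -
  have "partial_mixed_norm M p (\<lambda>x. c * F x) l (\<lambda>_. undefined)
      = c * partial_mixed_norm M p F l (\<lambda>_. undefined)"
    by (intro partial_mixed_norm_cmult[where l = l] M p F) auto
  moreover have eq: "mixed_norm l M p H = partial_mixed_norm M p H l (\<lambda>_. undefined)" for H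
    by (rule mixed_norm_eq_partial_mixed_norm) (use assms in auto)
  ultimately show ?thesis
    by (simp only:)
qed

text \<open>In each variable, with exponent \<open>r\<close>, raising to the power \<open>r\<close> turns the claim into Minkowski's
  inequality for the exponent \<open>q / r\<close>, which is at least 1 precisely because \<open>q\<close> dominates all
  the exponents.\<close>

lemma moment_norm_partial_mixed_norm_le:
  assumes P: "sigma_finite_measure P"
    and M: "\<And>j. j \<in> {1..l} \<Longrightarrow> sigma_finite_measure (M j)"
    and p: "\<And>j. j \<in> {1..l} \<Longrightarrow> 0 < p j \<and> p j \<le> q"
    and F: "(\<lambda>(x, \<omega>). F \<omega> x) \<in> borel_measurable (PiM {1..l} M \<Otimes>\<^sub>M P)"
    and "k \<le> l" and "x \<in> space (PiM {Suc k..l} M)"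
  shows "moment_norm P q (\<lambda>\<omega>. partial_mixed_norm M p (F \<omega>) k x)
    \<le> partial_mixed_norm M p (\<lambda>x. moment_norm P q (\<lambda>\<omega>. F \<omega> x)) k x"
  using \<open>k \<le> l\<close> \<open>x \<in> _\<close>
proof (induction k arbitrary: x)
  case (Suc k)
  define r where "r = p (Suc k)"
  have r: "0 < r" "r \<le> q"
    using p[of "Suc k"] Suc.prems by (auto simp: r_def)
  let ?N = "\<lambda>\<omega> y. partial_mixed_norm M p (F \<omega>) k (x(Suc k := y))"
  let ?R = "\<lambda>y. partial_mixed_norm M p (\<lambda>x. moment_norm P q (\<lambda>\<omega>. F \<omega> x)) k (x(Suc k := y))"
  have [measurable]: "(\<lambda>(\<omega>, y). ?N \<omega> y) \<in> borel_measurable (P \<Otimes>\<^sub>M M (Suc k))"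
    using Suc.prems by (intro measurable_partial_mixed_norm_section[OF M F]) auto
  have "moment_norm P q (\<lambda>\<omega>. partial_mixed_norm M p (F \<omega>) (Suc k) x)
    = ((\<integral>\<^sup>+\<omega>. (\<integral>\<^sup>+y. ?N \<omega> y epowr r \<partial>M (Suc k)) epowr (q / r) \<partial>P) epowr (1 / (q / r))) epowr (1 / r)"
    using r by (simp add: moment_norm_def epowr_epowr flip: r_def)
  also have "\<dots> \<le> (\<integral>\<^sup>+y. (\<integral>\<^sup>+\<omega>. (?N \<omega> y epowr r) epowr (q / r) \<partial>P) epowr (1 / (q / r)) \<partial>M (Suc k)) epowr (1 / r)"
    using r Suc.prems by (intro epowr_mono minkowski_integral P M) (auto simp: field_simps)
  also have "\<dots> = (\<integral>\<^sup>+y. moment_norm P q (\<lambda>\<omega>. ?N \<omega> y) epowr r \<partial>M (Suc k)) epowr (1 / r)"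
    using r by (simp add: moment_norm_def epowr_epowr)
  also have "\<dots> \<le> (\<integral>\<^sup>+y. ?R y epowr r \<partial>M (Suc k)) epowr (1 / r)"
    using r Suc.prems by (intro epowr_mono nn_integral_mono Suc.IH fun_upd_in_space_PiM) auto
  finally show ?case
    by (simp add: r_def)
qed simp

lemma moment_norm_mixed_norm_le:
  assumes "1 \<le> l" "sigma_finite_measure P"
    and M: "\<And>j. j \<in> {1..l} \<Longrightarrow> sigma_finite_measure (M j)"
    and p: "\<And>j. j \<in> {1..l} \<Longrightarrow> 0 < p j \<and> p j \<le> q"
    and F: "(\<lambda>(x, \<omega>). F \<omega> x) \<in> borel_measurable (PiM {1..l} M \<Otimes>\<^sub>M P)"
  shows "moment_norm P q (\<lambda>\<omega>. mixed_norm l M p (F \<omega>))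
    \<le> mixed_norm l M p (\<lambda>x. moment_norm P q (\<lambda>\<omega>. F \<omega> x))"
proof -
  have "p j \<noteq> 0" if "j \<in> {1..l}" for j
    using p[OF that] by simp
  then have eq: "mixed_norm l M p H = partial_mixed_norm M p H l (\<lambda>_. undefined)" for H
    using \<open>1 \<le> l\<close> by (intro mixed_norm_eq_partial_mixed_norm)
  show ?thesis
    unfolding eq by (intro moment_norm_partial_mixed_norm_le[where l = l] assms) auto
qed

section \<open>Rosenthal's inequality at a single point\<close>

lemma moment_norm_cong_distr:
  fixes X Y :: "'w \<Rightarrow> real"
  assumes [measurable]: "X \<in> borel_measurable P" "Y \<in> borel_measurable P"
    and eq: "distr P borel X = distr P borel Y"
  shows "moment_norm P q (\<lambda>\<omega>. ennreal \<bar>X \<omega>\<bar>) = moment_norm P q (\<lambda>\<omega>. ennreal \<bar>Y \<omega>\<bar>)"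
proof -
  have "(\<integral>\<^sup>+\<omega>. ennreal \<bar>X \<omega>\<bar> epowr q \<partial>P) = (\<integral>\<^sup>+z. ennreal \<bar>z\<bar> epowr q \<partial>distr P borel X)"
    by (subst nn_integral_distr) auto
  also have "\<dots> = (\<integral>\<^sup>+\<omega>. ennreal \<bar>Y \<omega>\<bar> epowr q \<partial>P)"
    unfolding eq by (subst nn_integral_distr) auto
  finally show ?thesis
    by (simp add: moment_norm_def)
qed

lemma centered_cong_distr:
  fixes X Y :: "'w \<Rightarrow> real"
  assumes [measurable]: "X \<in> borel_measurable P" "Y \<in> borel_measurable P"
    and eq: "distr P borel X = distr P borel Y"
  shows "centered P X \<longleftrightarrow> centered P Y"
proof -
  have "integrable P Z \<longleftrightarrow> integrable (distr P borel Z) (\<lambda>z. z)"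
    and "(\<integral>\<omega>. Z \<omega> \<partial>P) = (\<integral>z. z \<partial>distr P borel Z)"
    if [measurable]: "Z \<in> borel_measurable P" for Z :: "'w \<Rightarrow> real"
    by (rule integrable_distr_eq[symmetric] integral_distr[symmetric]; measurable)+
  from this[OF assms(1)] this[OF assms(2)] show ?thesis
    by (simp only: centered_def eq)
qed

lemma moment_norm_eq_0_iff:
  assumes [measurable]: "Z \<in> borel_measurable P"
  shows "moment_norm P q Z = 0 \<longleftrightarrow> (AE \<omega> in P. Z \<omega> = 0)"
  by (simp add: moment_norm_def nn_integral_0_iff_AE)

lemma rosenthal_ratio_le:
  assumes "1 \<le> n" "iid_copies P borel (\<zeta> 1) \<zeta>" "centered P (\<zeta> 1)"
    and "0 < moment_norm P q (\<lambda>\<omega>. ennreal \<bar>\<zeta> 1 \<omega>\<bar>)"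
    and "moment_norm P q (\<lambda>\<omega>. ennreal \<bar>\<zeta> 1 \<omega>\<bar>) < \<infinity>"
  shows "moment_norm P q (\<lambda>\<omega>. ennreal \<bar>normalized_sum (\<lambda>k. \<zeta> k \<omega>) n\<bar>)
      / moment_norm P q (\<lambda>\<omega>. ennreal \<bar>\<zeta> 1 \<omega>\<bar>) \<le> rosenthal_const P q"
  unfolding rosenthal_const_def
proof (rule SUP_upper2[where i = n], use assms(1) in simp, rule SUP_upper2[where i = \<zeta>])
qed (use assms(2-) in blast, rule order_refl)

text \<open>The supremum that defines the Rosenthal constant only admits variables with a positive finite
  moment. If the moment of \<open>X\<close> vanishes, then so do all copies and their sum; if it is infinite, the
  right-hand side is infinite as long as the factor is positive. The constant \<open>c\<close> provides this
  positivity: the Rosenthal constant itself is 0 when no admissible variable exists on \<open>P\<close>.\<close>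

lemma moment_norm_normalized_sum_le:
  fixes X :: "'w \<Rightarrow> real"
  assumes P: "prob_space P"
    and X [measurable]: "X \<in> borel_measurable P" and cX: "centered P X"
    and iid: "iid_copies P borel X \<zeta>"
    and n: "1 \<le> n" and c: "rosenthal_const P q \<le> c" "0 < c"
  shows "moment_norm P q (\<lambda>\<omega>. ennreal \<bar>normalized_sum (\<lambda>k. \<zeta> k \<omega>) n\<bar>)
    \<le> c * moment_norm P q (\<lambda>\<omega>. ennreal \<bar>X \<omega>\<bar>)"
proof -
  interpret prob_space P by fact
  have \<zeta> [measurable]: "\<zeta> k \<in> borel_measurable P" if "1 \<le> k" for k
    using iid that by (auto simp: iid_copies_def indep_vars_def)
  have distr: "distr P borel (\<zeta> k) = distr P borel X" if "1 \<le> k" for k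
    using iid that by (simp add: iid_copies_def)
  have moment: "moment_norm P q (\<lambda>\<omega>. ennreal \<bar>\<zeta> k \<omega>\<bar>) = moment_norm P q (\<lambda>\<omega>. ennreal \<bar>X \<omega>\<bar>)"
    if "1 \<le> k" for k
    using that by (intro moment_norm_cong_distr \<zeta> X distr)
  let ?S = "moment_norm P q (\<lambda>\<omega>. ennreal \<bar>normalized_sum (\<lambda>k. \<zeta> k \<omega>) n\<bar>)"
  let ?m = "moment_norm P q (\<lambda>\<omega>. ennreal \<bar>X \<omega>\<bar>)"
  have [measurable]: "(\<lambda>\<omega>. normalized_sum (\<lambda>k. \<zeta> k \<omega>) n) \<in> borel_measurable P"
    unfolding normalized_sum_def by (intro borel_measurable_times borel_measurable_sum) auto
  consider "?m = 0" | "?m = \<top>" | "0 < ?m" "?m < \<top>"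
    by (cases "?m = 0"; cases "?m = \<top>") (auto simp: less_top zero_less_iff_neq_zero)
  then show ?thesis
  proof cases
    case 1
    have "AE \<omega> in P. \<forall>k\<in>{1..n}. \<zeta> k \<omega> = 0"
    proof (rule AE_finite_allI)
      fix k assume "k \<in> {1..n}"
      then have "AE \<omega> in P. ennreal \<bar>\<zeta> k \<omega>\<bar> = 0"
        using 1 moment[of k] moment_norm_eq_0_iff[of "\<lambda>\<omega>. ennreal \<bar>\<zeta> k \<omega>\<bar>" P q]
        by simp
      then show "AE \<omega> in P. \<zeta> k \<omega> = 0"
        by (simp add: ennreal_eq_0_iff)
    qed simp
    then have "AE \<omega> in P. ennreal \<bar>normalized_sum (\<lambda>k. \<zeta> k \<omega>) n\<bar> = 0"
      by eventually_elim (simp add: normalized_sum_def)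
    then have "?S = 0"
      by (subst moment_norm_eq_0_iff) simp_all
    then show ?thesis by simp
  next
    case 2
    then show ?thesis
      using c by (simp add: ennreal_mult_top)
  next
    case 3
    have "iid_copies P borel (\<zeta> 1) \<zeta>"
      using iid distr by (simp add: iid_copies_def)
    moreover have "centered P (\<zeta> 1)"
      using cX centered_cong_distr[OF \<zeta> X distr, of 1] by simp
    ultimately have "?S / moment_norm P q (\<lambda>\<omega>. ennreal \<bar>\<zeta> 1 \<omega>\<bar>) \<le> rosenthal_const P q"
      using 3 n moment[of 1] by (intro rosenthal_ratio_le) simp_all
    then have "?S / ?m \<le> c"
      using c moment[of 1] by simp
    then have "?S / ?m * ?m \<le> c * ?m"
      by (rule mult_right_mono) simp
    then show ?thesis
      using 3 by (simp add: ennreal_divide_times)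
  qed
qed

text \<open>Evaluation at \<open>x\<close> is a measurable map on the path space, so independence and equality in
  distribution pass from the paths to their values at \<open>x\<close>.\<close>

lemma iid_copies_section:
  assumes "prob_space P" and x: "x \<in> X"
    and \<xi>: "\<And>x. x \<in> X \<Longrightarrow> \<xi> x \<in> borel_measurable P"
    and copies: "independent_field_copies P X \<xi> \<eta>"
  shows "iid_copies P borel (\<xi> x) (\<lambda>k. \<eta> k x)"
proof -
  interpret prob_space P by fact
  have indep: "indep_vars (\<lambda>_. path_space X) (\<lambda>k. path X (\<eta> k)) {1..}"
    and distr: "\<And>k. 1 \<le> k \<Longrightarrow> distr P (path_space X) (path X (\<eta> k)) = distr P (path_space X) (path X \<xi>)"
    using copies by (auto simp: independent_field_copies_def iid_copies_def)
  have eval [measurable]: "(\<lambda>f. f x) \<in> borel_measurable (path_space X)"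
    unfolding path_space_def using x by (rule measurable_component_singleton)
  have path: "path X \<xi> \<in> P \<rightarrow>\<^sub>M path_space X"
    unfolding path_space_def path_def using \<xi> by (intro measurable_restrict)
  have "indep_vars (\<lambda>_. borel) (\<lambda>k \<omega>. path X (\<eta> k) \<omega> x) {1..}"
    by (rule indep_vars_compose2[OF indep]) measurable
  moreover have "distr P borel (\<eta> k x) = distr P borel (\<xi> x)" if "1 \<le> k" for k
  proof -
    have \<eta>: "path X (\<eta> k) \<in> P \<rightarrow>\<^sub>M path_space X"
      using indep that by (auto simp: indep_vars_def)
    have "distr P borel (\<eta> k x) = distr (distr P (path_space X) (path X (\<eta> k))) borel (\<lambda>f. f x)"
      using x by (subst distr_distr[OF eval \<eta>]) (simp add: path_def comp_def)
    also have "\<dots> = distr P borel (\<xi> x)"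
      unfolding distr[OF that] using x by (subst distr_distr[OF eval path]) (simp add: path_def comp_def)
    finally show ?thesis .
  qed
  ultimately show ?thesis
    using x by (simp add: iid_copies_def path_def)
qed

section \<open>Moments of mixed norms of normalized sums\<close>

theorem theorem3p2:
  fixes P :: "'w measure"
    and l :: nat
    and M :: "nat \<Rightarrow> 'a measure"
    and p :: "nat \<Rightarrow> real"
    and pbar m :: real
    and \<xi> :: "(nat \<Rightarrow> 'a) \<Rightarrow> 'w \<Rightarrow> real"
    and \<xi>s :: "nat \<Rightarrow> (nat \<Rightarrow> 'a) \<Rightarrow> 'w \<Rightarrow> real"
  assumes "prob_space P"
    and "l \<ge> 2"
    and "\<And>k. k \<in> {1..l} \<Longrightarrow> sigma_finite_measure (M k)"
    and "\<And>k. k \<in> {1..l} \<Longrightarrow> separable_measure (M k)"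
    and "\<And>k. k \<in> {1..l} \<Longrightarrow> emeasure (M k) (space (M k)) \<noteq> 0"
    and "\<And>k. k \<in> {1..l} \<Longrightarrow> 1 \<le> p k"
    and "pbar = Max (p ` {1..l})"
    and "pbar \<ge> 2"
    and "(\<lambda>(x, \<omega>). \<xi> x \<omega>) \<in> borel_measurable (PiM {1..l} M \<Otimes>\<^sub>M P)"
    and "AE x in PiM {1..l} M. centered P (\<xi> x)"
    and "\<And>k. k \<ge> 1 \<Longrightarrow> (\<lambda>(x, \<omega>). \<xi>s k x \<omega>) \<in> borel_measurable (PiM {1..l} M \<Otimes>\<^sub>M P)"
    and "independent_field_copies P (space (PiM {1..l} M)) \<xi> \<xi>s"
    and "m \<ge> 1"
    and "(\<lambda>x. moment_norm P (m * pbar) (\<lambda>\<omega>. ennreal \<bar>\<xi> x \<omega>\<bar>)) \<in> mixed_Lp l M p"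
  shows "(SUP n\<in>{1..}. moment_norm P (m * pbar)
            (\<lambda>\<omega>. mixed_norm l M p (\<lambda>x. ennreal \<bar>normalized_sum (\<lambda>k. \<xi>s k x \<omega>) n\<bar>)))
         \<le> rosenthal_const P (m * pbar) *
            mixed_norm l M p (\<lambda>x. moment_norm P (m * pbar) (\<lambda>\<omega>. ennreal \<bar>\<xi> x \<omega>\<bar>))"
proof (rule SUP_least)
  fix n :: nat assume "n \<in> {1..}"
  then have n: "1 \<le> n" by simp
  note M = assms(3) and joint = assms(9) and copies = assms(12)
  interpret prob_space P by fact
  have l: "1 \<le> l" using \<open>l \<ge> 2\<close> by simp
  define q where "q = m * pbar"
  have p: "0 < p j \<and> p j \<le> q" if "j \<in> {1..l}" for j
  proof -
    have "p j \<le> pbar"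
      using that assms(7) by simp
    also have "pbar \<le> q"
      using \<open>m \<ge> 1\<close> \<open>pbar \<ge> 2\<close> by (simp add: q_def)
    finally show ?thesis
      using assms(6)[OF that] by simp
  qed
  have p_pos: "0 < p j" "p j \<noteq> 0" if "j \<in> {1..l}" for j
    using p[OF that] by auto
  define F where "F x = moment_norm P q (\<lambda>\<omega>. ennreal \<bar>\<xi> x \<omega>\<bar>)" for x
  define G where "G \<omega> x = ennreal \<bar>normalized_sum (\<lambda>k. \<xi>s k x \<omega>) n\<bar>" for \<omega> x
  have F: "F \<in> borel_measurable (PiM {1..l} M)" "mixed_norm l M p F < \<infinity>"
    using assms(14) by (simp_all add: mixed_Lp_def F_def[abs_def] q_def)
  have G: "(\<lambda>(x, \<omega>). G \<omega> x) \<in> borel_measurable (PiM {1..l} M \<Otimes>\<^sub>M P)"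
  proof -
    have [measurable]: "(\<lambda>z. \<xi>s k (fst z) (snd z)) \<in> borel_measurable (PiM {1..l} M \<Otimes>\<^sub>M P)"
      if "k \<in> {1..n}" for k
      using assms(11)[of k] that by (simp add: case_prod_beta)
    show ?thesis
      unfolding G_def normalized_sum_def case_prod_beta by measurable
  qed
  have \<xi>: "\<xi> x \<in> borel_measurable P" if "x \<in> space (PiM {1..l} M)" for x
    using measurable_compose[OF measurable_Pair1'[OF that] joint] by simp
  let ?K = "rosenthal_const P q"
  \<comment> \<open>The positive \<open>e\<close> makes the pointwise bound trivial where the moment of the field is
    infinite.\<close>
  have bound: "moment_norm P q (\<lambda>\<omega>. mixed_norm l M p (G \<omega>)) \<le> (?K + ennreal e) * mixed_norm l M p F"
    if "0 < e" for e
  proof -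
    have "moment_norm P q (\<lambda>\<omega>. mixed_norm l M p (G \<omega>))
      \<le> mixed_norm l M p (\<lambda>x. moment_norm P q (\<lambda>\<omega>. G \<omega> x))"
      by (intro moment_norm_mixed_norm_le l M p G sigma_finite_measure_axioms)
    also have "\<dots> \<le> mixed_norm l M p (\<lambda>x. (?K + ennreal e) * F x)"
    proof (rule mixed_norm_mono_AE[OF l M p_pos(1)])
      from assms(10) AE_space
      show "AE x in PiM {1..l} M. moment_norm P q (\<lambda>\<omega>. G \<omega> x) \<le> (?K + ennreal e) * F x"
      proof eventually_elim
        case (elim x)
        show ?case
          unfolding F_def G_def
        proof (rule moment_norm_normalized_sum_le[OF prob_space_axioms])
          show "iid_copies P borel (\<xi> x) (\<lambda>k. \<xi>s k x)"
            by (rule iid_copies_section[OF prob_space_axioms _ _ copies]) (use elim \<xi> in auto)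
        qed (use elim \<xi> n \<open>0 < e\<close> in \<open>auto simp: add_pos_nonneg add_nonneg_pos\<close>)
      qed
    qed
    also have "\<dots> = (?K + ennreal e) * mixed_norm l M p F"
      by (intro mixed_norm_cmult l M p_pos(2) F)
    finally show ?thesis .
  qed
  have "moment_norm P q (\<lambda>\<omega>. mixed_norm l M p (G \<omega>)) \<le> ?K * mixed_norm l M p F"
  proof (rule ennreal_le_epsilon)
    fix e :: real assume "0 < e"
    obtain a where a: "mixed_norm l M p F = ennreal a" "0 \<le> a"
      using F by (cases "mixed_norm l M p F") auto
    define d where "d = e / (a + 1)"
    have d: "0 < d" "d * a \<le> e"
      using \<open>0 < e\<close> a by (simp_all add: d_def field_simps)
    have "moment_norm P q (\<lambda>\<omega>. mixed_norm l M p (G \<omega>))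
      \<le> ?K * mixed_norm l M p F + ennreal d * ennreal a"
      using bound[OF d(1)] a by (simp add: distrib_right)
    also have "\<dots> \<le> ?K * mixed_norm l M p F + ennreal e"
      using d a ennreal_leI[OF d(2)] by (intro add_left_mono) (simp add: ennreal_mult)
    finally show "moment_norm P q (\<lambda>\<omega>. mixed_norm l M p (G \<omega>)) \<le> ?K * mixed_norm l M p F + ennreal e" .
  qed
  then show "moment_norm P (m * pbar)
      (\<lambda>\<omega>. mixed_norm l M p (\<lambda>x. ennreal \<bar>normalized_sum (\<lambda>k. \<xi>s k x \<omega>) n\<bar>))
    \<le> rosenthal_const P (m * pbar) *
      mixed_norm l M p (\<lambda>x. moment_norm P (m * pbar) (\<lambda>\<omega>. ennreal \<bar>\<xi> x \<omega>\<bar>))"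
    unfolding F_def G_def q_def .
qed

end
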